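(* Let $S$ be a topological monoid. If $S$ is discrete, then its dual inverse monoid $S^{\odot}$ is compact. If $S$ is compact, then its dual inverse monoid $S^{\odot}$ is discrete.
   Context: All topological spaces are assumed Hausdorff. A monoid is a semigroup with a two-sided unit $1$; a topological monoid is a monoid endowed with a (Hausdorff) topology making the multiplication continuous. A monoid homomorphism $h:S\to M$ is a function with $h(1)=1$ and $h(xy)=h(x)h(y)$ for all $x,y\in S$. Let $\dot{\mathbb T}=\{z\in\mathbb C:|z|\in\{0,1\}\}$, with the multiplication of complex numbers and the topology inherited from $\mathbb C$. For a topological monoid $S$, the dual inverse monoid $S^{\odot}$ is the set of all continuous monoid homomorphisms $S\to\dot{\mathbb T}$, endowed with pointwise multiplication and the compact-open topology. *)

theory Defs
  imports "HOL-Analysis.Analysis" "HOL-Algebra.Group"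
begin

text \<open>The points are the continuous maps into \<open>Y\<close>. The domain is a whole type, so such maps
  are determined by their values and need no extensionality convention.\<close>

definition compact_open_topology :: "'b topology \<Rightarrow> ('a::topological_space \<Rightarrow> 'b) topology" where
  "compact_open_topology Y =
     topology_generated_by
       {{f. continuous_map euclidean Y f \<and> f ` K \<subseteq> U} | K U. compact K \<and> openin Y U}"

lemma topspace_compact_open_topology [simp]:
  "topspace (compact_open_topology Y) = {f::'a::topological_space \<Rightarrow> 'b. continuous_map euclidean Y f}"
proof -
  have "{f::'a \<Rightarrow> 'b. continuous_map euclidean Y f} =
        {f. continuous_map euclidean Y f \<and> f ` {} \<subseteq> topspace Y}"
    by simp
  then have "{f::'a \<Rightarrow> 'b. continuous_map euclidean Y f} \<in>
      {{f. continuous_map euclidean Y f \<and> f ` K \<subseteq> U} | K U. compact K \<and> openin Y U}"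
    by (intro CollectI exI[of _ "{}"] exI[of _ "topspace Y"]) auto
  then show ?thesis
    unfolding compact_open_topology_def topology_generated_by_topspace by blast
qed

lemma openin_compact_open_topology:
  fixes K :: "'a::topological_space set"
  assumes "compact K" "openin Y U"
  shows "openin (compact_open_topology Y) {f. continuous_map euclidean Y f \<and> f ` K \<subseteq> U}"
  unfolding compact_open_topology_def
  by (rule topology_generated_by_Basis) (use assms in blast)

lemma Hausdorff_space_compact_open_topology:
  assumes "Hausdorff_space Y"
  shows "Hausdorff_space (compact_open_topology Y :: ('a::topological_space \<Rightarrow> 'b) topology)"
  unfolding Hausdorff_space_def
proof (intro allI impI, elim conjE)
  fix f g :: "'a \<Rightarrow> 'b"
  assume f: "f \<in> topspace (compact_open_topology Y)"
    and g: "g \<in> topspace (compact_open_topology Y)" and "f \<noteq> g"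
  from \<open>f \<noteq> g\<close> obtain x where x: "f x \<noteq> g x" by blast
  have "f x \<in> topspace Y" "g x \<in> topspace Y"
    using f g by (auto simp: continuous_map_def)
  then obtain U V where UV: "openin Y U" "openin Y V" "f x \<in> U" "g x \<in> V" "disjnt U V"
    using assms x unfolding Hausdorff_space_def by blast
  let ?N = "\<lambda>W. {h. continuous_map euclidean Y h \<and> h ` {x} \<subseteq> W}"
  have "openin (compact_open_topology Y) (?N U)" "openin (compact_open_topology Y) (?N V)"
    using UV by (simp_all only: openin_compact_open_topology compact_sing)
  moreover have "f \<in> ?N U" "g \<in> ?N V" "disjnt (?N U) (?N V)"
    using f g UV by (auto simp: disjnt_def)
  ultimately show "\<exists>A B. openin (compact_open_topology Y) A \<and> openin (compact_open_topology Y) B \<and>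
      f \<in> A \<and> g \<in> B \<and> disjnt A B"
    by blast
qed

definition dotT :: "complex set" where
  "dotT = {z. cmod z \<in> {0, 1}}"

text \<open>A Hausdorff topological monoid is a type of sort
  \<open>{t2_space, topological_semigroup_mult, monoid_mult}\<close>. Its dual, being a set of
  functions, is a record with an explicit carrier, and its topology a value of type \<open>topology\<close>.\<close>

definition dual_monoid ::
    "('a::{t2_space, topological_semigroup_mult, monoid_mult} \<Rightarrow> complex) monoid" where
  "dual_monoid =
     \<lparr>carrier = {h. continuous_map euclidean (top_of_set dotT) h \<and>
                    h 1 = 1 \<and> (\<forall>x y. h (x * y) = h x * h y)},
      monoid.mult = (\<lambda>f g x. f x * g x),
      one = (\<lambda>x. 1)\<rparr>"

definition dual_topology ::
    "('a::{t2_space, topological_semigroup_mult, monoid_mult} \<Rightarrow> complex) topology" where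
  "dual_topology = subtopology (compact_open_topology (top_of_set dotT)) (carrier dual_monoid)"

lemma dotT_mult: "z \<in> dotT \<Longrightarrow> w \<in> dotT \<Longrightarrow> z * w \<in> dotT"
  by (auto simp: dotT_def norm_mult)

lemma comm_monoid_dual_monoid:
  "comm_monoid (dual_monoid ::
     ('a::{t2_space, topological_semigroup_mult, monoid_mult} \<Rightarrow> complex) monoid)"
proof (rule comm_monoidI)
  fix f g :: "'a \<Rightarrow> complex"
  assume "f \<in> carrier dual_monoid" "g \<in> carrier dual_monoid"
  then show "f \<otimes>\<^bsub>dual_monoid\<^esub> g \<in> carrier dual_monoid"
    by (auto simp: dual_monoid_def continuous_map_in_subtopology image_subset_iff Pi_iff mult_ac
        intro!: continuous_on_mult dotT_mult)
qed (auto simp: dual_monoid_def continuous_map_in_subtopology dotT_def mult_ac)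

lemma topspace_dual_topology [simp]: "topspace dual_topology = carrier dual_monoid"
  by (auto simp: dual_topology_def dual_monoid_def)

lemma Hausdorff_space_dual_topology: "Hausdorff_space dual_topology"
  unfolding dual_topology_def
  by (intro Hausdorff_space_subtopology Hausdorff_space_compact_open_topology
      Hausdorff_space_subtopology Hausdorff_space_euclidean)

end

theory Submission
  imports Defs
begin

text \<open>For discrete \<open>S\<close> the compact sets are finite, so the dual is a closed subspace of the
  Tychonoff power of the compact set \<open>dotT\<close>. For compact \<open>S\<close>, a character that is uniformly
  \<open>1/2\<close>-close to \<open>h\<close> has the same zeros as \<open>h\<close>, and elsewhere the powers of its quotient by \<open>h\<close>
  stay close to \<open>1\<close>, so it equals \<open>h\<close>. Covering \<open>dotT\<close> by finitely many small balls shows that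
  such characters form a neighbourhood of \<open>h\<close>.\<close>

lemma compact_dotT: "compact dotT"
proof -
  have "dotT = insert 0 (sphere 0 1)"
    by (auto simp: dotT_def)
  then show ?thesis
    by (metis compact_insert compact_sphere)
qed

text \<open>Squaring a point within \<open>1/2\<close> of \<open>1\<close> multiplies its distance to \<open>1\<close> by \<open>norm (z + 1) \<ge> 3/2\<close>.\<close>

lemma powers_near_one_imp_eq_one:
  fixes z :: "'a::real_normed_field"
  assumes "\<And>n. norm (z ^ n - 1) \<le> 1 / 2"
  shows "z = 1"
proof (rule ccontr)
  assume "z \<noteq> 1"
  have growth: "(3 / 2) ^ k * norm (z - 1) \<le> norm (z ^ (2 ^ k) - 1)" for k :: nat
  proof (induction k)
    case (Suc k)
    let ?w = "z ^ (2 ^ k)"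
    have "2 - norm (?w - 1) \<le> norm (?w + 1)"
      using norm_triangle_ineq2[of "2::'a" "1 - ?w"]
      by (simp add: norm_minus_commute algebra_simps)
    then have "3 / 2 \<le> norm (?w + 1)"
      using assms[of "2 ^ k"] by linarith
    then have "(3 / 2) * ((3 / 2) ^ k * norm (z - 1)) \<le> norm (?w + 1) * norm (?w - 1)"
      using Suc by (intro mult_mono) auto
    also have "\<dots> = norm (z ^ (2 ^ Suc k) - 1)"
    proof -
      have "z ^ (2 ^ Suc k) - 1 = (?w + 1) * (?w - 1)"
        by (simp add: power2_eq_square[of ?w] square_diff_one_factored power_even_eq)
      then show ?thesis
        by (simp only: norm_mult)
    qed
    finally show ?case
      by (simp add: mult.assoc)
  qed simp
  \<comment> \<open>By \<open>growth\<close>, this \<open>k\<close> puts \<open>z ^ (2 ^ k)\<close>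
    at distance more than 1 from 1.\<close>
  obtain k where "1 / norm (z - 1) < (3 / 2 :: real) ^ k"
    using real_arch_pow[of "3 / 2 :: real"] by auto
  then have "1 < (3 / 2) ^ k * norm (z - 1)"
    using \<open>z \<noteq> 1\<close> by (simp add: field_simps)
  then show False
    using growth[of k] assms[of "2 ^ k"] by linarith
qed

lemma multiplicative_power:
  fixes f :: "'a::monoid_mult \<Rightarrow> 'b::monoid_mult"
  assumes "f 1 = 1" "\<And>x y. f (x * y) = f x * f y"
  shows "f (x ^ n) = f x ^ n"
  by (induction n) (auto simp: assms)

lemma dual_monoid_near_imp_eq:
  assumes f: "f \<in> carrier dual_monoid" and h: "h \<in> carrier dual_monoid"
    and near: "\<And>x. dist (f x) (h x) \<le> 1 / 2"
  shows "f = h"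
proof
  fix x
  have fx: "f x \<in> dotT" and hx: "h x \<in> dotT"
    using f h by (auto simp: dual_monoid_def continuous_map_in_subtopology)
  show "f x = h x"
  proof (cases "h x = 0")
    case True
    \<comment> \<open>Here \<open>f x\<close> has norm at most 1/2, and the only such point of
      \<open>dotT\<close> is 0.\<close>
    then show ?thesis
      using near[of x] fx by (auto simp: dotT_def)
  next
    case False
    then have one: "norm (h x) = 1"
      using hx by (auto simp: dotT_def)
    have "norm ((f x / h x) ^ n - 1) \<le> 1 / 2" for n
    proof -
      \<comment> \<open>Powers of the quotient are quotients of values at \<open>x ^ n\<close>,
        where \<open>near\<close> applies again; dividing by a number of norm 1 preserves
        distances.\<close>
      have "(f x / h x) ^ n - 1 = (f (x ^ n) - h (x ^ n)) / h x ^ n"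
        using f h False
        by (simp add: multiplicative_power dual_monoid_def power_divide diff_divide_distrib)
      then have "norm ((f x / h x) ^ n - 1) = dist (f (x ^ n)) (h (x ^ n))"
        by (simp add: norm_divide norm_power one dist_norm)
      then show ?thesis
        using near by simp
    qed
    then have "f x / h x = 1"
      by (rule powers_near_one_imp_eq_one)
    then show ?thesis
      using False by simp
  qed
qed

lemma dual_topology_eq_discrete:
  assumes S: "compact (UNIV :: 'a::{t2_space, topological_semigroup_mult, monoid_mult} set)"
  shows "(dual_topology :: ('a \<Rightarrow> complex) topology) = discrete_topology (carrier dual_monoid)"
proof -
  have "openin dual_topology {h}" if h: "h \<in> carrier dual_monoid" for h :: "'a \<Rightarrow> complex"
  proof -
    have hcont: "continuous_on UNIV h" and hdot: "h x \<in> dotT" for x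
      using h by (auto simp: dual_monoid_def continuous_map_in_subtopology)
    \<comment> \<open>Closed balls of radius 1/8 make each \<open>?K c\<close> closed, hence
      compact. The open ball of radius 1/4 contains them, so \<open>h\<close> lies in every
      \<open>?N c\<close>; and 1/8 + 1/4 stays below the 1/2 allowed by
      \<open>dual_monoid_near_imp_eq\<close>.\<close>
    obtain C where C: "finite C" "dotT \<subseteq> (\<Union>c\<in>C. ball c (1 / 8))"
      using compact_dotT[unfolded compact_eq_totally_bounded] by (meson zero_less_divide_1_iff zero_less_numeral)
    let ?K = "\<lambda>c. h -` cball c (1 / 8)"
    let ?N = "\<lambda>c. carrier dual_monoid \<inter>
      {f. continuous_map euclidean (top_of_set dotT) f \<and> f ` ?K c \<subseteq> dotT \<inter> ball c (1 / 4)}"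
    have "compact (?K c)" for c
      using closed_vimage[OF closed_cball hcont] compact_Int_closed[OF S, of "?K c"] by simp
    then have "openin dual_topology (?N c)" for c
      unfolding dual_topology_def
      by (intro openin_subtopology_Int2 openin_compact_open_topology openin_open_Int) auto
    \<comment> \<open>An intersection over an empty \<open>C\<close> would be all functions, not
      only characters.\<close>
    moreover have "C \<noteq> {}"
      using C(2) hdot by auto
    ultimately have "openin dual_topology (\<Inter>c\<in>C. ?N c)"
      using \<open>finite C\<close> by (intro openin_INT2)
    moreover have "(\<Inter>c\<in>C. ?N c) = {h}"
    proof (intro equalityI subsetI)
      fix f assume f: "f \<in> (\<Inter>c\<in>C. ?N c)"
      have "dist (f x) (h x) \<le> 1 / 2" for x
      proof -
        obtain c where c: "c \<in> C" "dist c (h x) < 1 / 8"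
          using C(2) hdot[of x] by auto
        then have "f x \<in> ball c (1 / 4)"
          using f by (fastforce simp: image_subset_iff)
        then show ?thesis
          using c dist_triangle[of "f x" "h x" c] by (simp add: dist_commute)
      qed
      then show "f \<in> {h}"
        using dual_monoid_near_imp_eq f h \<open>C \<noteq> {}\<close> by blast
    next
      fix f assume "f \<in> {h}"
      then show "f \<in> (\<Inter>c\<in>C. ?N c)"
        using h hdot by (auto simp: dual_monoid_def)
    qed
    ultimately show ?thesis
      by simp
  qed
  then show ?thesis
    by (subst eq_commute, subst discrete_topology_unique) auto
qed

text \<open>\<open>compact\<close> refers to the product topology on the function type. Continuity
  is automatic on a discrete domain, so only equations between coordinates remain, and these cut a
  closed set out of a product of copies of \<open>dotT\<close>.\<close>

lemma compact_carrier_dual_monoid: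
  assumes S: "(euclidean :: 'a::{t2_space, topological_semigroup_mult, monoid_mult} topology)
    = discrete_topology UNIV"
  shows "compact (carrier dual_monoid :: ('a \<Rightarrow> complex) set)"
proof -
  have "compact (Pi\<^sub>E UNIV (\<lambda>_. dotT) :: ('a \<Rightarrow> complex) set)"
    using compact_dotT
    by (simp flip: compactin_euclidean_iff euclidean_product_topology add: compactin_PiE)
  moreover have "closed {h :: 'a \<Rightarrow> complex. h 1 = 1 \<and> (\<forall>x y. h (x * y) = h x * h y)}"
    by (intro closed_Collect_conj closed_Collect_all closed_Collect_eq continuous_intros
        continuous_on_product_coordinates)
  moreover have "(carrier dual_monoid :: ('a \<Rightarrow> complex) set) =
      Pi\<^sub>E UNIV (\<lambda>_. dotT) \<inter> {h. h 1 = 1 \<and> (\<forall>x y. h (x * y) = h x * h y)}"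
    unfolding dual_monoid_def S by auto
  ultimately show ?thesis
    by (simp only: compact_Int_closed)
qed

text \<open>The identity from the product topology to the compact-open topology is continuous on the
  characters, so compactness carries over to the dual.\<close>

lemma compact_space_dual_topology:
  assumes S: "(euclidean :: 'a::{t2_space, topological_semigroup_mult, monoid_mult} topology)
    = discrete_topology UNIV"
  shows "compact_space (dual_topology :: ('a \<Rightarrow> complex) topology)"
proof -
  let ?D = "carrier dual_monoid :: ('a \<Rightarrow> complex) set"
  let ?Y = "top_of_set dotT"
  have "openin (top_of_set ?D)
      ((\<lambda>h. h) -` {f. continuous_map euclidean ?Y f \<and> f ` K \<subseteq> U} \<inter> topspace (top_of_set ?D))"
    if K: "compact K" and U: "openin ?Y U" for K :: "'a set" and U
  proof -
    have "finite K"
      using K by (simp flip: compactin_euclidean_iff add: S compactin_discrete_topology)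
    obtain V where V: "open V" "U = dotT \<inter> V"
      using U by (auto simp: openin_open)
    \<comment> \<open>As \<open>K\<close> is finite, mapping \<open>K\<close> into \<open>V\<close>
      amounts to finitely many open conditions on coordinates.\<close>
    have "open {h :: 'a \<Rightarrow> complex. h x \<in> V}" for x
      using open_vimage[OF \<open>open V\<close> continuous_on_product_coordinates] by (simp add: vimage_def)
    then have "open (\<Inter>x\<in>K. {h :: 'a \<Rightarrow> complex. h x \<in> V})"
      using \<open>finite K\<close> by blast
    then have "openin (top_of_set ?D) (?D \<inter> (\<Inter>x\<in>K. {h. h x \<in> V}))"
      by (rule openin_open_Int)
    also have "?D \<inter> (\<Inter>x\<in>K. {h. h x \<in> V}) =
        (\<lambda>h. h) -` {f. continuous_map euclidean ?Y f \<and> f ` K \<subseteq> U} \<inter> topspace (top_of_set ?D)"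
      by (auto simp: V dual_monoid_def continuous_map_in_subtopology)
    finally show ?thesis .
  qed
  moreover have "?D \<subseteq> topspace (compact_open_topology ?Y)"
    by (auto simp: dual_monoid_def)
  \<comment> \<open>Continuity need only be tested on the generating sets, which was done
    above.\<close>
  ultimately have "continuous_map (top_of_set ?D) (compact_open_topology ?Y) (\<lambda>h. h)"
    unfolding compact_open_topology_def topology_generated_by_topspace
    by (intro continuous_on_generated_topo) auto
  then have "continuous_map (top_of_set ?D) dual_topology (\<lambda>h. h)"
    by (auto simp: dual_topology_def continuous_map_in_subtopology)
  moreover have "compactin (top_of_set ?D) ?D"
    using compact_carrier_dual_monoid[OF S] by (simp add: compactin_subtopology)
  ultimately have "compactin dual_topology ((\<lambda>h. h) ` ?D)"
    by (rule image_compactin[rotated])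
  then show ?thesis
    by (simp add: compact_space_def)
qed

theorem theorem3:
  shows "((euclidean ::
            'a::{t2_space, topological_semigroup_mult, monoid_mult} topology) = discrete_topology UNIV
          \<longrightarrow> compact_space (dual_topology :: ('a \<Rightarrow> complex) topology))
       \<and> (compact (UNIV :: 'a set)
          \<longrightarrow> (dual_topology :: ('a \<Rightarrow> complex) topology)
                = discrete_topology (carrier dual_monoid))"
  using compact_space_dual_topology dual_topology_eq_discrete by blast

end
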